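(* Fix $\theta$ and a function $\alpha$. Suppose that i) there is a distribution $F_\alpha$ such that $\alpha(F_\alpha)=\alpha$ and $\gamma(F_\tau^\alpha)=\gamma_0$ for $F_\tau^\alpha=(1-\tau)F_\alpha+\tau F_0$ and all $\tau\in[0,\bar\tau)$, for some $\bar\tau>0$; ii) $\frac{d}{d\tau}\int g(w,\gamma(F_\tau^\alpha),\theta)F_\alpha(dw)=\int\phi(w,\gamma_0,\alpha,\theta)F_0(dw)$. Then $E[\phi(W,\gamma_0,\alpha,\theta)]=0$.
   Context: $W$ is a data observation with true distribution $F_0$, and $E[\cdot]$ is expectation under $F_0$. $g(w,\gamma,\theta)$ is a vector of known functions of a realization $w$, an unknown function $\gamma$ and a finite dimensional parameter $\theta$; $\phi(w,\gamma,\alpha,\theta)$ (the nonparametric influence function) is a vector of functions of the same dimension depending also on an additional unknown function $\alpha$. $F\mapsto\gamma(F)$ and $F\mapsto\alpha(F)$ are maps from distributions of $W$ to functions (the probability limits of estimators $\hat\gamma,\hat\alpha$ when $W$ has distribution $F$), with $\gamma_0=\gamma(F_0)$. $d/d\tau$ denotes the derivative from the right at $\tau=0$. *)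

theory Defs
  imports "HOL-Probability.Probability"
begin

text \<open>
  The mixture \<open>(1 - \<tau>) F + \<tau> G\<close> of two distributions on the same measurable space. The weights
  are coerced by \<^const>\<open>ennreal\<close>, which truncates negative reals, so this is the intended object only
  for \<open>0 \<le> \<tau> \<le> 1\<close>.
\<close>

definition mixture :: "real \<Rightarrow> 'w measure \<Rightarrow> 'w measure \<Rightarrow> 'w measure" where
  "mixture \<tau> F G =
     measure_of (space F) (sets F)
       (\<lambda>A. ennreal (1 - \<tau>) * emeasure F A + ennreal \<tau> * emeasure G A)"

lemma space_mixture [simp]: "space (mixture \<tau> F G) = space F"
  by (simp add: mixture_def space_measure_of_conv)

lemma sets_mixture [simp, measurable_cong]: "sets (mixture \<tau> F G) = sets F"
  by (simp add: mixture_def)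

lemma emeasure_mixture:
  assumes "sets G = sets F" and A: "A \<in> sets F"
  shows "emeasure (mixture \<tau> F G) A = ennreal (1 - \<tau>) * emeasure F A + ennreal \<tau> * emeasure G A"
  unfolding mixture_def
proof (rule emeasure_measure_of_sigma)
  show "sigma_algebra (space F) (sets F)"
    by (rule sets.sigma_algebra_axioms)
  show "positive (sets F) (\<lambda>A. ennreal (1 - \<tau>) * emeasure F A + ennreal \<tau> * emeasure G A)"
    by (simp add: positive_def)
  show "countably_additive (sets F)
          (\<lambda>A. ennreal (1 - \<tau>) * emeasure F A + ennreal \<tau> * emeasure G A)"
  proof (rule countably_additiveI)
    fix B :: "nat \<Rightarrow> 'a set"
    assume B: "range B \<subseteq> sets F" "disjoint_family B" "(\<Union>i. B i) \<in> sets F"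
    then have "(\<Sum>i. emeasure F (B i)) = emeasure F (\<Union>i. B i)"
      and "(\<Sum>i. emeasure G (B i)) = emeasure G (\<Union>i. B i)"
      using assms by (auto intro!: suminf_emeasure)
    then show "(\<Sum>i. ennreal (1 - \<tau>) * emeasure F (B i) + ennreal \<tau> * emeasure G (B i)) =
        ennreal (1 - \<tau>) * emeasure F (\<Union>i. B i) + ennreal \<tau> * emeasure G (\<Union>i. B i)"
      by (simp add: suminf_add[symmetric])
  qed
qed (rule A)

lemma mixture_in_prob_algebra:
  assumes "F \<in> space (prob_algebra M)" and "G \<in> space (prob_algebra M)"
    and "0 \<le> \<tau>" and "\<tau> \<le> 1"
  shows "mixture \<tau> F G \<in> space (prob_algebra M)"
proof -
  have s: "sets F = sets M" "sets G = sets M" and p: "prob_space F" "prob_space G"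
    using assms by (auto simp: space_prob_algebra)
  have "space G = space F"
    using s by (metis sets_eq_imp_space_eq)
  then have "emeasure F (space F) = 1" "emeasure G (space F) = 1"
    using p prob_space.emeasure_space_1 by metis+
  then have "emeasure (mixture \<tau> F G) (space F) = ennreal (1 - \<tau>) + ennreal \<tau>"
    using s by (subst emeasure_mixture) auto
  also have "\<dots> = 1"
    using assms(3,4) by (simp flip: ennreal_plus)
  finally show ?thesis
    using s by (auto simp: space_prob_algebra intro!: prob_spaceI)
qed

end

theory Submission
  imports Defs
begin

text \<open>The integral of \<open>g\<close> is taken under the fixed law \<open>F\<alpha>\<close>,
  so it varies with \<tau> only through \<open>\<gamma>_lim\<close> of the mixture, which stays at
  \<open>\<gamma>0\<close> on \<open>{0..<\<tau>bar}\<close>. The integral is thus constant near 0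
  and its right derivative is 0. By uniqueness of one-sided derivatives
  (\<open>vector_derivative_unique_within\<close>), the mean of \<phi> under \<open>F0\<close>
  vanishes; \<open>integral_distr\<close> carries this over to \<open>P\<close>.\<close>

theorem theorem2:
  fixes P :: "'s measure" and M :: "'w measure" and W :: "'s \<Rightarrow> 'w"
    and F0 F\<alpha> :: "'w measure"
    and g :: "'w \<Rightarrow> ('x \<Rightarrow> 'y) \<Rightarrow> real ^ 'p \<Rightarrow> real ^ 'q"
    and \<phi> :: "'w \<Rightarrow> ('x \<Rightarrow> 'y) \<Rightarrow> ('u \<Rightarrow> 'v) \<Rightarrow> real ^ 'p \<Rightarrow> real ^ 'q"
    and \<gamma>_lim :: "'w measure \<Rightarrow> ('x \<Rightarrow> 'y)"
    and \<alpha>_lim :: "'w measure \<Rightarrow> ('u \<Rightarrow> 'v)"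
    and \<gamma>0 :: "'x \<Rightarrow> 'y" and \<alpha> :: "'u \<Rightarrow> 'v" and \<theta> :: "real ^ 'p"
    and \<tau>bar :: real
  assumes "prob_space P" and "W \<in> measurable P M"
    and "F0 = distr P M W"
    and "\<gamma>0 = \<gamma>_lim F0"
    and "F\<alpha> \<in> space (prob_algebra M)"
    and "\<alpha>_lim F\<alpha> = \<alpha>"
    and "0 < \<tau>bar" and "\<tau>bar \<le> 1"
    and "\<And>\<tau>. \<tau> \<in> {0..<\<tau>bar} \<Longrightarrow> \<gamma>_lim (mixture \<tau> F\<alpha> F0) = \<gamma>0"
    and "\<And>\<tau>. \<tau> \<in> {0..<\<tau>bar} \<Longrightarrow> integrable F\<alpha> (\<lambda>w. g w (\<gamma>_lim (mixture \<tau> F\<alpha> F0)) \<theta>)"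
    and "integrable F0 (\<lambda>w. \<phi> w \<gamma>0 \<alpha> \<theta>)"
    and "((\<lambda>\<tau>. \<integral>w. g w (\<gamma>_lim (mixture \<tau> F\<alpha> F0)) \<theta> \<partial>F\<alpha>)
           has_vector_derivative (\<integral>w. \<phi> w \<gamma>0 \<alpha> \<theta> \<partial>F0)) (at_right 0)"
  shows "prob_space.expectation P (\<lambda>\<omega>. \<phi> (W \<omega>) \<gamma>0 \<alpha> \<theta>) = 0"
proof -
  define h where "h = (\<lambda>\<tau>. \<integral>w. g w (\<gamma>_lim (mixture \<tau> F\<alpha> F0)) \<theta> \<partial>F\<alpha>)"
  have const: "h \<tau> = (\<integral>w. g w \<gamma>0 \<theta> \<partial>F\<alpha>)" if "0 \<le> \<tau>" "\<tau> < \<tau>bar" for \<tau>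
    using that assms(9) by (simp add: h_def)
  have "eventually (\<lambda>\<tau>. h \<tau> = (\<integral>w. g w \<gamma>0 \<theta> \<partial>F\<alpha>)) (at_right 0)"
    using eventually_at_right_real[OF assms(7)] by eventually_elim (simp add: const)
  \<comment> \<open>\<open>at_right 0\<close> and \<open>at 0 within {0..}\<close> are the same
    filter; the closed half-line is used because the transfer rule below requires the base point 0
    to lie in the set.\<close>
  then have ev: "eventually (\<lambda>\<tau>. (\<integral>w. g w \<gamma>0 \<theta> \<partial>F\<alpha>) = h \<tau>) (at 0 within {0..})"
    by (simp add: at_within_Ici_at_right eq_commute)
  have "((\<lambda>_. \<integral>w. g w \<gamma>0 \<theta> \<partial>F\<alpha>) has_vector_derivative 0) (at 0 within {0..})"
    by simp
  then have "(h has_vector_derivative 0) (at 0 within {0..})"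
    unfolding has_vector_derivative_def
    \<comment> \<open>Difference quotients also involve \<open>h 0\<close>, about which
      \<open>ev\<close> says nothing; \<open>const[of 0]\<close> supplies it.\<close>
    by (rule has_derivative_transform_eventually[OF _ ev]) (use assms(7) const[of 0] in auto)
  then have "(h has_vector_derivative 0) (at_right 0)"
    by (simp add: at_within_Ici_at_right)
  moreover have "(h has_vector_derivative (\<integral>w. \<phi> w \<gamma>0 \<alpha> \<theta> \<partial>F0)) (at_right 0)"
    using assms(12) by (simp add: h_def)
  \<comment> \<open>Uniqueness holds because 0 is a limit point of \<open>{0<..}\<close>, so the
    filter is nontrivial.\<close>
  ultimately have "(\<integral>w. \<phi> w \<gamma>0 \<alpha> \<theta> \<partial>F0) = 0"
    using vector_derivative_unique_within[of 0 "{0<..}" h] trivial_limit_at_right_real[of 0]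
    by (metis trivial_limit_def)
  \<comment> \<open>Measurability needed for the change of variables along \<open>W\<close>;
    \<open>F0\<close> has the sigma-algebra of \<open>M\<close>.\<close>
  moreover have "(\<lambda>w. \<phi> w \<gamma>0 \<alpha> \<theta>) \<in> borel_measurable M"
    using borel_measurable_integrable[OF assms(11)] by (simp add: assms(3))
  ultimately show ?thesis
    using assms(2) by (simp add: assms(3) integral_distr)
qed

end
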